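(* Let $\mathsf{Q}=(\mathsf{Q},\&,k)$ be a non-trivial, commutative and unital quantale. Then every $\mathsf{Q}$-map is the graph of a map in $\mathbf{Set}$ if, and only if, $\mathsf{Q}$ is lean. In this case, $\mathbf{Set}$ and $\mathsf{Q}\text{-}\mathbf{Map}$ are isomorphic categories.
   Context: A non-trivial, commutative and unital quantale $\mathsf{Q}=(\mathsf{Q},\&,k)$ is a complete lattice $\mathsf{Q}$ (top $\top$, bottom $\bot$) with a commutative monoid structure $(\mathsf{Q},\&,k)$ such that $\bot<k$ and $p\mathbin{\&}\bigvee_{i\in I} q_i=\bigvee_{i\in I} p\mathbin{\&}q_i$ for all families. For sets $X,Y$, a $\mathsf{Q}$-relation $\phi\colon X\nrightarrow Y$ is a function $\phi\colon X\times Y\to\mathsf{Q}$; $\mathsf{Q}$-relations are ordered pointwise. The composite of $\phi\colon X\nrightarrow Y$ and $\psi\colon Y\nrightarrow Z$ is $(\psi\circ\phi)(x,z)=\bigvee_{y\in Y}\psi(y,z)\mathbin{\&}\phi(x,y)$; the identity is $\mathrm{id}_X(x,x)=k$ and $\mathrm{id}_X(x,y)=\bot$ for $x\ne y$. A $\mathsf{Q}$-map from $X$ to $Y$ is a $\mathsf{Q}$-relation $\zeta\colon X\nrightarrow Y$ having a right adjoint, i.e. there is $\eta\colon Y\nrightarrow X$ with $\mathrm{id}_X\le\eta\circ\zeta$ and $\zeta\circ\eta\le\mathrm{id}_Y$. $\mathsf{Q}\text{-}\mathbf{Map}$ is the category of sets and $\mathsf{Q}$-maps, in which composition is the composition $\circ$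 of $\mathsf{Q}$-relations, $(\psi\circ\phi)(x,z)=\bigvee_{y\in Y}\psi(y,z)\mathbin{\&}\phi(x,y)$, and the identity on $X$ is the $\mathsf{Q}$-relation $\mathrm{id}_X$. The graph of a map $f\colon X\to Y$ of sets is the $\mathsf{Q}$-map $f_\circ\colon X\nrightarrow Y$ with $f_\circ(x,y)=k$ if $y=f(x)$ and $f_\circ(x,y)=\bot$ otherwise. ("Every $\mathsf{Q}$-map" means for all sets $X,Y$ and all $\mathsf{Q}$-maps from $X$ to $Y$.) $\mathsf{Q}$ is lean if for all $p,q\in\mathsf{Q}$: (i) $p\vee q=k$ and $p\mathbin{\&}q=\bot$ imply $p=k$ or $q=k$; and (ii) $p\mathbin{\&}q=k$ if and only if $p=q=k$. *)

theory Defs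
  imports Main "HOL-Library.FuncSet"
begin

text \<open>The multiplication of the quantale is written \<open>*\<close> and its unit \<open>1\<close>. Families enter
  suprema only through their range, so distributivity is stated for subsets.\<close>

class comm_unital_quantale = complete_lattice + comm_monoid_mult +
  assumes mult_Sup_distrib: "p * Sup A = (SUP q\<in>A. p * q)"

class nontrivial_comm_unital_quantale = comm_unital_quantale +
  assumes bot_less_one: "bot < 1"

definition lean :: "'q::comm_unital_quantale itself \<Rightarrow> bool" where
  "lean _ \<longleftrightarrow>
     (\<forall>p q :: 'q. sup p q = 1 \<and> p * q = bot \<longrightarrow> p = 1 \<or> q = 1) \<and>
     (\<forall>p q :: 'q. p * q = 1 \<longleftrightarrow> p = 1 \<and> q = 1)"


text \<open>Relations between sets \<open>X\<close> and \<open>Y\<close> are extensional functions on \<open>X \<times> Y\<close>, so that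
  equality of relations is HOL equality.\<close>

definition qrel :: "'a set \<Rightarrow> 'b set \<Rightarrow> ('a \<times> 'b \<Rightarrow> 'q::comm_unital_quantale) set" where
  "qrel X Y = X \<times> Y \<rightarrow>\<^sub>E UNIV"

definition qrel_le ::
  "'a set \<Rightarrow> 'b set \<Rightarrow> ('a \<times> 'b \<Rightarrow> 'q::comm_unital_quantale) \<Rightarrow> ('a \<times> 'b \<Rightarrow> 'q) \<Rightarrow> bool" where
  "qrel_le X Y \<phi> \<psi> \<longleftrightarrow> (\<forall>x\<in>X. \<forall>y\<in>Y. \<phi> (x, y) \<le> \<psi> (x, y))"

definition qrel_comp ::
  "'a set \<Rightarrow> 'b set \<Rightarrow> 'c set \<Rightarrow> ('b \<times> 'c \<Rightarrow> 'q::comm_unital_quantale) \<Rightarrow> ('a \<times> 'b \<Rightarrow> 'q)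
     \<Rightarrow> ('a \<times> 'c \<Rightarrow> 'q)" where
  "qrel_comp X Y Z \<psi> \<phi> = (\<lambda>(x, z) \<in> X \<times> Z. SUP y\<in>Y. \<psi> (y, z) * \<phi> (x, y))"

definition qrel_id :: "'a set \<Rightarrow> ('a \<times> 'a \<Rightarrow> 'q::comm_unital_quantale)" where
  "qrel_id X = (\<lambda>(x, y) \<in> X \<times> X. if x = y then 1 else bot)"

definition is_qmap ::
  "'a set \<Rightarrow> 'b set \<Rightarrow> ('a \<times> 'b \<Rightarrow> 'q::comm_unital_quantale) \<Rightarrow> bool" where
  "is_qmap X Y \<zeta> \<longleftrightarrow> \<zeta> \<in> qrel X Y \<and>
     (\<exists>\<eta> \<in> qrel Y X.
        qrel_le X X (qrel_id X) (qrel_comp X Y X \<eta> \<zeta>) \<and>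
        qrel_le Y Y (qrel_comp Y X Y \<zeta> \<eta>) (qrel_id Y))"

definition qgraph ::
  "'a set \<Rightarrow> 'b set \<Rightarrow> ('a \<Rightarrow> 'b) \<Rightarrow> ('a \<times> 'b \<Rightarrow> 'q::comm_unital_quantale)" where
  "qgraph X Y f = (\<lambda>(x, y) \<in> X \<times> Y. if y = f x then 1 else bot)"


text \<open>Categories are given by hom-sets, which need not be disjoint; composition is therefore
  indexed by objects: \<open>Comp C X Y Z g f\<close> is \<open>g \<circ> f\<close> for \<open>f \<in> Hom C X Y\<close> and \<open>g \<in> Hom C Y Z\<close>.
  Likewise, the action of a functor on \<open>Hom C X Y\<close> is indexed by \<open>X\<close> and \<open>Y\<close>.\<close>

record ('o, 'm) cat =
  Ob :: "'o set"
  Hom :: "'o \<Rightarrow> 'o \<Rightarrow> 'm set"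
  Id :: "'o \<Rightarrow> 'm"
  Comp :: "'o \<Rightarrow> 'o \<Rightarrow> 'o \<Rightarrow> 'm \<Rightarrow> 'm \<Rightarrow> 'm"

definition is_category :: "('o, 'm) cat \<Rightarrow> bool" where
  "is_category C \<longleftrightarrow>
     (\<forall>X\<in>Ob C. Id C X \<in> Hom C X X) \<and>
     (\<forall>X\<in>Ob C. \<forall>Y\<in>Ob C. \<forall>Z\<in>Ob C. \<forall>f\<in>Hom C X Y. \<forall>g\<in>Hom C Y Z.
        Comp C X Y Z g f \<in> Hom C X Z) \<and>
     (\<forall>X\<in>Ob C. \<forall>Y\<in>Ob C. \<forall>f\<in>Hom C X Y.
        Comp C X X Y f (Id C X) = f \<and> Comp C X Y Y (Id C Y) f = f) \<and>
     (\<forall>W\<in>Ob C. \<forall>X\<in>Ob C. \<forall>Y\<in>Ob C. \<forall>Z\<in>Ob C.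
        \<forall>f\<in>Hom C W X. \<forall>g\<in>Hom C X Y. \<forall>h\<in>Hom C Y Z.
        Comp C W Y Z h (Comp C W X Y g f) = Comp C W X Z (Comp C X Y Z h g) f)"

definition is_functor ::
  "('o1, 'm1) cat \<Rightarrow> ('o2, 'm2) cat \<Rightarrow> ('o1 \<Rightarrow> 'o2) \<Rightarrow> ('o1 \<Rightarrow> 'o1 \<Rightarrow> 'm1 \<Rightarrow> 'm2) \<Rightarrow> bool" where
  "is_functor C D Fo Fm \<longleftrightarrow> is_category C \<and> is_category D \<and>
     (\<forall>X\<in>Ob C. Fo X \<in> Ob D) \<and>
     (\<forall>X\<in>Ob C. \<forall>Y\<in>Ob C. \<forall>f\<in>Hom C X Y. Fm X Y f \<in> Hom D (Fo X) (Fo Y)) \<and>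
     (\<forall>X\<in>Ob C. Fm X X (Id C X) = Id D (Fo X)) \<and>
     (\<forall>X\<in>Ob C. \<forall>Y\<in>Ob C. \<forall>Z\<in>Ob C. \<forall>f\<in>Hom C X Y. \<forall>g\<in>Hom C Y Z.
        Fm X Z (Comp C X Y Z g f) = Comp D (Fo X) (Fo Y) (Fo Z) (Fm Y Z g) (Fm X Y f))"

definition isomorphic_categories :: "('o1, 'm1) cat \<Rightarrow> ('o2, 'm2) cat \<Rightarrow> bool" where
  "isomorphic_categories C D \<longleftrightarrow>
     (\<exists>Fo Fm Go Gm. is_functor C D Fo Fm \<and> is_functor D C Go Gm \<and>
        (\<forall>X\<in>Ob C. Go (Fo X) = X) \<and>
        (\<forall>X\<in>Ob C. \<forall>Y\<in>Ob C. \<forall>f\<in>Hom C X Y. Gm (Fo X) (Fo Y) (Fm X Y f) = f) \<and>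
        (\<forall>X\<in>Ob D. Fo (Go X) = X) \<and>
        (\<forall>X\<in>Ob D. \<forall>Y\<in>Ob D. \<forall>f\<in>Hom D X Y. Fm (Go X) (Go Y) (Gm X Y f) = f))"


text \<open>HOL has no type of all sets. The universe of sets is the collection of all subsets of
  a type \<open>'u\<close>, which stays a type variable.\<close>

definition Set_cat :: "('u set, 'u \<Rightarrow> 'u) cat" where
  "Set_cat = \<lparr>
     Ob = UNIV,
     Hom = (\<lambda>X Y. X \<rightarrow>\<^sub>E Y),
     Id = (\<lambda>X. \<lambda>x\<in>X. x),
     Comp = (\<lambda>X Y Z g f. compose X g f)\<rparr>"

definition QMap_cat :: "('u set, 'u \<times> 'u \<Rightarrow> 'q::comm_unital_quantale) cat" where
  "QMap_cat = \<lparr>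
     Ob = UNIV,
     Hom = (\<lambda>X Y. {\<zeta>. is_qmap X Y \<zeta>}),
     Id = qrel_id,
     Comp = qrel_comp\<rparr>"

end

theory Submission
  imports Defs
begin

text \<open>If \<open>\<zeta>\<close> has right adjoint \<open>\<eta>\<close>, then for a fixed \<open>x\<close> the elements
  \<open>p y = \<eta> (y, x) * \<zeta> (x, y)\<close> form a partition of the unit: their supremum is \<open>1\<close>, and the product
  of any two of them with different indices is \<open>bot\<close>. So \<open>\<zeta>\<close> is a graph as soon as, for each \<open>x\<close>,
  some part is \<open>1\<close> and both of its factors are \<open>1\<close>. The two clauses of leanness provide this. The
  first clause, on partitions into two parts, already forces every partition of the unit to contain
  \<open>1\<close>: split off one part and collect the others by their supremum
  (\<open>orthogonal_cover_contains_one\<close>). The second clause makes both factors of that part equal to \<open>1\<close>.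

  Conversely, a partition of \<open>1\<close> into two parts is a Q-map from one point to two points, which is
  where the universe must have two elements, and either factor of a factorization of \<open>1\<close> is a Q-map
  from a point to itself. If these are graphs, then \<open>Q\<close> is lean.

  When all Q-maps are graphs, taking graphs is a bijection on hom-sets that is the identity on
  objects and preserves composition, and so it carries the category structure of sets over to
  Q-maps (\<open>isomorphic_categoriesI\<close>).\<close>

section \<open>Quantale arithmetic\<close>

lemma mult_bot [simp]:
  fixes p :: "'q::comm_unital_quantale"
  shows "p * bot = bot" and "bot * p = bot"
  using mult_Sup_distrib[of p "{}"] by (simp_all add: mult.commute)

lemma mult_SUP_distrib:
  fixes p :: "'q::comm_unital_quantale"
  shows "p * (SUP i\<in>I. q i) = (SUP i\<in>I. p * q i)"
  by (simp add: mult_Sup_distrib image_image)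

lemma mult_sup_distrib:
  fixes p :: "'q::comm_unital_quantale"
  shows "p * sup q r = sup (p * q) (p * r)"
  using mult_Sup_distrib[of p "{q, r}"] by simp

lemma mult_mono_right:
  fixes p :: "'q::comm_unital_quantale"
  assumes "q \<le> r"
  shows "p * q \<le> p * r"
proof -
  have "sup (p * q) (p * r) = p * r"
    using mult_sup_distrib[of p q r] assms by (simp add: sup.absorb2)
  then show ?thesis
    by (simp add: sup.absorb_iff2)
qed

lemma lean_orthogonal:
  fixes p q :: "'q::comm_unital_quantale"
  assumes "lean TYPE('q)" "sup p q = 1" "p * q = bot"
  shows "p = 1 \<or> q = 1"
  using assms unfolding lean_def by blast

lemma lean_factor:
  fixes p q :: "'q::comm_unital_quantale"
  assumes "lean TYPE('q)" "p * q = 1"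
  shows "p = 1" "q = 1"
  using assms unfolding lean_def by blast+

text \<open>If the part \<open>p y\<close> is not \<open>1\<close>, then by leanness the supremum of the others is \<open>1\<close>; since \<open>p y\<close> is
  orthogonal to it, \<open>p y = bot\<close>. This cannot happen for all \<open>y\<close>, as the parts have supremum \<open>1\<close>.\<close>

lemma orthogonal_cover_contains_one:
  fixes p :: "'i \<Rightarrow> 'q::nontrivial_comm_unital_quantale"
  assumes lean: "lean TYPE('q)"
    and cover: "(SUP y\<in>Y. p y) = 1"
    and orthogonal: "\<And>y y'. y \<in> Y \<Longrightarrow> y' \<in> Y \<Longrightarrow> y \<noteq> y' \<Longrightarrow> p y * p y' = bot"
  shows "\<exists>y\<in>Y. p y = 1"
proof (rule ccontr)
  assume no_one: "\<not> (\<exists>y\<in>Y. p y = 1)"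
  have "p y = bot" if y: "y \<in> Y" for y
  proof -
    define q where "q = (SUP y'\<in>Y - {y}. p y')"
    have "p y * q = (SUP y'\<in>Y - {y}. p y * p y')"
      unfolding q_def by (rule mult_SUP_distrib)
    also have "\<dots> = bot"
      using orthogonal[OF y] by auto
    finally have zero: "p y * q = bot" .
    have "sup (p y) q = (SUP y'\<in>insert y (Y - {y}). p y')"
      by (simp only: q_def SUP_insert)
    then have "sup (p y) q = 1"
      using y cover by (simp add: insert_absorb)
    then have "q = 1"
      using lean_orthogonal[OF lean _ zero] no_one y by blast
    then show ?thesis
      using zero by simp
  qed
  then have "(SUP y\<in>Y. p y) \<le> bot"
    by (intro SUP_least) simp
  then show False
    using cover bot_less_one[where 'a = 'q] by (simp add: bot_unique)
qed

section \<open>Q-maps and graphs\<close>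

text \<open>The unit of the adjunction need only be checked on the diagonal, since \<open>qrel_id\<close> is \<open>bot\<close> off
  it, and the counit, having suprema on its smaller side, can be checked term by term. Hence the
  adjunction amounts to conditions at each \<open>x\<close> separately.\<close>

lemma is_qmap_iff:
  fixes \<zeta> :: "'a \<times> 'b \<Rightarrow> 'q::comm_unital_quantale"
  shows "is_qmap X Y \<zeta> \<longleftrightarrow> \<zeta> \<in> qrel X Y \<and>
    (\<exists>h. (\<forall>x\<in>X. 1 \<le> (SUP y\<in>Y. h y x * \<zeta> (x, y))) \<and>
         (\<forall>x\<in>X. \<forall>y\<in>Y. \<forall>y'\<in>Y. \<zeta> (x, y') * h y x \<le> (if y = y' then 1 else bot)))"
    (is "_ \<longleftrightarrow> _ \<and> (\<exists>h. ?P h)")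
proof -
  have adjoint_iff: "qrel_le X X (qrel_id X) (qrel_comp X Y X \<eta> \<zeta>) \<and>
      qrel_le Y Y (qrel_comp Y X Y \<zeta> \<eta>) (qrel_id Y) \<longleftrightarrow> ?P (\<lambda>y x. \<eta> (y, x))" for \<eta>
    unfolding qrel_le_def qrel_comp_def qrel_id_def
    by (auto simp: SUP_le_iff)
  have "(\<exists>\<eta>\<in>qrel Y X. ?P (\<lambda>y x. \<eta> (y, x))) \<longleftrightarrow> (\<exists>h. ?P h)"
  proof
    assume "\<exists>\<eta>\<in>qrel Y X. ?P (\<lambda>y x. \<eta> (y, x))"
    then show "\<exists>h. ?P h"
      by (elim bexE) (rule exI)
  next
    assume "\<exists>h. ?P h"
    then obtain h where h: "?P h"
      by (rule exE)
    let ?\<eta> = "\<lambda>(y, x)\<in>Y \<times> X. h y x"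
    have "?P (\<lambda>y x. ?\<eta> (y, x))"
      using h by simp
    moreover have "?\<eta> \<in> qrel Y X"
      by (simp add: qrel_def)
    ultimately show "\<exists>\<eta>\<in>qrel Y X. ?P (\<lambda>y x. \<eta> (y, x))"
      by (rule bexI[where P = "\<lambda>\<eta>. ?P (\<lambda>y x. \<eta> (y, x))"])
  qed
  then show ?thesis
    unfolding is_qmap_def adjoint_iff by simp
qed

lemma is_qmap_qgraph:
  assumes "f \<in> X \<rightarrow> Y"
  shows "is_qmap X Y (qgraph X Y f :: 'a \<times> 'b \<Rightarrow> 'q::comm_unital_quantale)"
proof -
  let ?h = "\<lambda>y x. if y = f x then 1 else bot :: 'q"
  have "1 \<le> (SUP y\<in>Y. ?h y x * qgraph X Y f (x, y))" if "x \<in> X" for x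
    using that assms by (intro SUP_upper2[of "f x"]) (auto simp: qgraph_def)
  then show ?thesis
    unfolding is_qmap_iff by (intro conjI exI[of _ ?h]) (auto simp: qgraph_def qrel_def)
qed

lemma qmap_is_qgraph:
  fixes \<zeta> :: "'a \<times> 'b \<Rightarrow> 'q::nontrivial_comm_unital_quantale"
  assumes lean: "lean TYPE('q)" and "is_qmap X Y \<zeta>"
  shows "\<exists>f \<in> X \<rightarrow>\<^sub>E Y. \<zeta> = qgraph X Y f"
proof -
  obtain h where \<zeta>: "\<zeta> \<in> qrel X Y"
    and unit: "\<And>x. x \<in> X \<Longrightarrow> 1 \<le> (SUP y\<in>Y. h y x * \<zeta> (x, y))"
    and counit: "\<And>x y y'. x \<in> X \<Longrightarrow> y \<in> Y \<Longrightarrow> y' \<in> Y \<Longrightarrow>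
      \<zeta> (x, y') * h y x \<le> (if y = y' then 1 else bot)"
    using assms(2) unfolding is_qmap_iff by blast
  have "\<exists>y\<in>Y. \<forall>y'\<in>Y. \<zeta> (x, y') = (if y' = y then 1 else bot)" if x: "x \<in> X" for x
  proof -
    define p where "p y = h y x * \<zeta> (x, y)" for y
    have off_diagonal: "\<zeta> (x, y') * h y x = bot" if "y \<in> Y" "y' \<in> Y" "y \<noteq> y'" for y y'
      using counit[OF x that(1,2)] that(3) by (simp add: bot_unique)
    have "(SUP y\<in>Y. p y) \<le> 1"
    proof (rule SUP_least)
      show "p y \<le> 1" if "y \<in> Y" for y
        using counit[OF x that that] by (simp add: p_def mult.commute)
    qed
    then have cover: "(SUP y\<in>Y. p y) = 1"
      using unit[OF x] by (simp add: p_def antisym)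
    have orthogonal: "p y * p y' = bot" if "y \<in> Y" "y' \<in> Y" "y \<noteq> y'" for y y'
    proof -
      have "p y * p y' = (\<zeta> (x, y') * h y x) * (\<zeta> (x, y) * h y' x)"
        by (simp add: p_def ac_simps)
      then show ?thesis
        using off_diagonal[OF that] by simp
    qed
    obtain y where y: "y \<in> Y" "h y x * \<zeta> (x, y) = 1"
      using orthogonal_cover_contains_one[OF lean cover orthogonal] by (auto simp: p_def)
    have "h y x = 1" "\<zeta> (x, y) = 1"
      using lean_factor[OF lean y(2)] by auto
    then show ?thesis
      using off_diagonal[OF y(1)] y(1) by fastforce
  qed
  then obtain g where g: "\<And>x. x \<in> X \<Longrightarrow> g x \<in> Y"
      "\<And>x y'. x \<in> X \<Longrightarrow> y' \<in> Y \<Longrightarrow> \<zeta> (x, y') = (if y' = g x then 1 else bot)"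
    by metis
  have "\<zeta> = qgraph X Y (restrict g X)"
    using \<zeta> g(2) by (intro extensionalityI[of _ "X \<times> Y"])
      (auto simp: qrel_def qgraph_def PiE_def)
  then show ?thesis
    using g(1) by (intro bexI[of _ "restrict g X"]) auto
qed

lemma qgraph_id: "qgraph X X (\<lambda>x\<in>X. x) = qrel_id X"
  by (auto simp: qgraph_def qrel_id_def fun_eq_iff restrict_def)

lemma qgraph_compose:
  assumes "f \<in> X \<rightarrow> Y"
  shows "(qgraph X Z (compose X g f) :: _ \<Rightarrow> 'q::comm_unital_quantale) =
    qrel_comp X Y Z (qgraph Y Z g) (qgraph X Y f)"
proof -
  have "(SUP y\<in>Y. qgraph Y Z g (y, z) * qgraph X Y f (x, y)) =
      (if z = g (f x) then 1 else bot :: 'q)" if "x \<in> X" "z \<in> Z" for x z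
  proof -
    have "f x \<in> Y"
      using assms that by auto
    \<comment> \<open>Only the term at \<open>y = f x\<close> differs from \<open>bot\<close>.\<close>
    have "(SUP y\<in>Y. qgraph Y Z g (y, z) * qgraph X Y f (x, y)) =
        (SUP y\<in>Y. if y = f x then (if z = g (f x) then 1 else bot) else bot :: 'q)"
      using that by (intro SUP_cong) (auto simp: qgraph_def)
    also have "\<dots> = (if z = g (f x) then 1 else bot)"
      using \<open>f x \<in> Y\<close> by (intro antisym SUP_least SUP_upper2[of "f x"]) auto
    finally show ?thesis .
  qed
  then show ?thesis
    by (auto simp: qrel_comp_def fun_eq_iff restrict_def)
      (auto simp: qgraph_def compose_def)
qed

lemma inj_on_qgraph:
  "inj_on (qgraph X Y :: _ \<Rightarrow> _ \<Rightarrow> 'q::nontrivial_comm_unital_quantale) (X \<rightarrow>\<^sub>E Y)"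
proof (rule inj_onI)
  fix f g
  assume fg: "f \<in> X \<rightarrow>\<^sub>E Y" "g \<in> X \<rightarrow>\<^sub>E Y"
    and eq: "(qgraph X Y f :: _ \<Rightarrow> 'q) = qgraph X Y g"
  show "f = g"
  proof (rule PiE_ext[OF fg])
    fix x assume "x \<in> X"
    with fg have "f x \<in> Y"
      by auto
    with \<open>x \<in> X\<close> have "(if f x = g x then 1 else bot :: 'q) = 1"
      using fun_cong[OF eq, of "(x, f x)"] by (auto simp: qgraph_def)
    then show "f x = g x"
      using bot_less_one[where 'a = 'q] by (auto split: if_splits)
  qed
qed

section \<open>Leanness from Q-maps on one point\<close>

text \<open>The relation is its own right adjoint, up to exchanging its arguments. For the unit,
  orthogonality gives \<open>sup (p * p) (q * q) = sup p q * sup p q = 1\<close>; for the counit, the diagonal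
  terms satisfy \<open>p * p \<le> p \<le> 1\<close>, and the off-diagonal ones are \<open>p * q = bot\<close>.\<close>

lemma is_qmap_orthogonal_pair:
  fixes p q :: "'q::comm_unital_quantale"
  assumes "sup p q = 1" "p * q = bot" "a \<noteq> b"
  shows "is_qmap {c} {a, b} (\<lambda>(x, y)\<in>{c} \<times> {a, b}. if y = a then p else q)"
proof -
  have "p \<le> 1" "q \<le> 1"
    using sup_ge1[of p q] sup_ge2[of q p] assms(1) by simp_all
  then have "p * p \<le> 1" "q * q \<le> 1"
    using mult_mono_right[of p 1 p] mult_mono_right[of q 1 q] by auto
  moreover have "sup (p * p) (q * q) = sup p q * sup p q"
    using assms(2) by (simp add: mult_sup_distrib mult.commute)
  ultimately show ?thesis
    unfolding is_qmap_iff using assms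
    by (intro conjI exI[of _ "\<lambda>y x. if y = a then p else q"])
      (auto simp: qrel_def mult.commute)
qed

lemma is_qmap_factor:
  fixes p q :: "'q::comm_unital_quantale"
  assumes "p * q = 1"
  shows "is_qmap {c} {a} (\<lambda>(x, y)\<in>{c} \<times> {a}. p)"
  unfolding is_qmap_iff using assms
  by (intro conjI exI[of _ "\<lambda>y x. q"]) (auto simp: qrel_def mult.commute)

lemma lean_if_qmaps_are_qgraphs:
  assumes "\<exists>a b :: 'u. a \<noteq> b"
    and graphs: "\<And>(X :: 'u set) (Y :: 'u set)
        (\<zeta> :: 'u \<times> 'u \<Rightarrow> 'q::nontrivial_comm_unital_quantale).
      is_qmap X Y \<zeta> \<Longrightarrow> \<exists>f \<in> X \<rightarrow>\<^sub>E Y. \<zeta> = qgraph X Y f"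
  shows "lean TYPE('q)"
proof -
  obtain a b :: 'u where ab: "a \<noteq> b"
    using assms(1) by blast
  have orthogonal: "p = 1 \<or> q = 1" if pq: "sup p q = 1" "p * q = bot" for p q :: 'q
  proof -
    obtain f where f: "f \<in> {a} \<rightarrow>\<^sub>E {a, b}" and
      eq: "(\<lambda>(x, y)\<in>{a} \<times> {a, b}. if y = a then p else q) = qgraph {a} {a, b} f"
      using graphs[OF is_qmap_orthogonal_pair[OF pq ab]] by blast
    have "f a = a \<or> f a = b"
      using f by auto
    then show ?thesis
      using fun_cong[OF eq, of "(a, a)"] fun_cong[OF eq, of "(a, b)"] ab
      by (auto simp: qgraph_def)
  qed
  have factor: "p = 1" if pq: "p * q = 1" for p q :: 'q
  proof -
    obtain f where f: "f \<in> {a} \<rightarrow>\<^sub>E {a}" and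
      eq: "(\<lambda>(x, y)\<in>{a} \<times> {a}. p) = qgraph {a} {a} f"
      using graphs[OF is_qmap_factor[OF pq]] by blast
    have "f a = a"
      using f by auto
    then show ?thesis
      using fun_cong[OF eq, of "(a, a)"] by (simp add: qgraph_def)
  qed
  show ?thesis
    unfolding lean_def
  proof (intro conjI allI impI iffI)
    show "q = 1" if "p * q = 1" for p q :: 'q
      using factor[of q p] that by (simp add: mult.commute)
  qed (use orthogonal factor in auto)
qed

section \<open>Isomorphism of categories\<close>

text \<open>Each morphism of \<open>D\<close> is an image under \<open>F\<close>, so the category laws of \<open>D\<close> are images of those
  of \<open>C\<close>. For Q-maps this replaces calculations with suprema.\<close>

lemma isomorphic_categoriesI:
  assumes C: "is_category C"
    and Ob: "Ob D = Ob C"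
    and bij: "\<And>X Y. X \<in> Ob C \<Longrightarrow> Y \<in> Ob C \<Longrightarrow> bij_betw (F X Y) (Hom C X Y) (Hom D X Y)"
    and Id: "\<And>X. X \<in> Ob C \<Longrightarrow> F X X (Id C X) = Id D X"
    and Comp: "\<And>X Y Z f g. X \<in> Ob C \<Longrightarrow> Y \<in> Ob C \<Longrightarrow> Z \<in> Ob C \<Longrightarrow>
      f \<in> Hom C X Y \<Longrightarrow> g \<in> Hom C Y Z \<Longrightarrow>
      F X Z (Comp C X Y Z g f) = Comp D X Y Z (F Y Z g) (F X Y f)"
  shows "isomorphic_categories C D"
proof -
  define G where "G X Y = inv_into (Hom C X Y) (F X Y)" for X Y
  have Hom: "Hom D X Y = F X Y ` Hom C X Y" if "X \<in> Ob C" "Y \<in> Ob C" for X Y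
    using bij[OF that] by (simp add: bij_betw_def)
  have GF: "G X Y (F X Y f) = f" if "X \<in> Ob C" "Y \<in> Ob C" "f \<in> Hom C X Y" for X Y f
    using bij[OF that(1,2)] that(3) by (simp add: G_def bij_betw_def)
  have C_id: "Id C X \<in> Hom C X X" if "X \<in> Ob C" for X
    using C that unfolding is_category_def by blast
  have C_comp: "Comp C X Y Z g f \<in> Hom C X Z"
    if "X \<in> Ob C" "Y \<in> Ob C" "Z \<in> Ob C" "f \<in> Hom C X Y" "g \<in> Hom C Y Z" for X Y Z f g
    using C that unfolding is_category_def by blast
  have C_unit: "Comp C X X Y f (Id C X) = f" "Comp C X Y Y (Id C Y) f = f"
    if "X \<in> Ob C" "Y \<in> Ob C" "f \<in> Hom C X Y" for X Y f
    using C that unfolding is_category_def by blast+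
  have C_assoc: "Comp C W Y Z h (Comp C W X Y g f) = Comp C W X Z (Comp C X Y Z h g) f"
    if "W \<in> Ob C" "X \<in> Ob C" "Y \<in> Ob C" "Z \<in> Ob C"
      "f \<in> Hom C W X" "g \<in> Hom C X Y" "h \<in> Hom C Y Z" for W X Y Z f g h
    using C that unfolding is_category_def by blast
  have D: "is_category D"
    unfolding is_category_def Ob
    by (auto simp: Hom Id[symmetric] Comp[symmetric] C_id C_comp C_unit C_assoc)
  have "is_functor C D (\<lambda>X. X) F"
    unfolding is_functor_def using C D by (auto simp: Ob Hom Id Comp)
  moreover have "is_functor D C (\<lambda>X. X) G"
    unfolding is_functor_def using C D
    by (auto simp: Ob Hom Id[symmetric] Comp[symmetric] GF C_id C_comp)
  moreover have "\<forall>X\<in>Ob D. \<forall>Y\<in>Ob D. \<forall>f\<in>Hom D X Y. F X Y (G X Y f) = f"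
    by (auto simp: Ob Hom GF)
  ultimately show ?thesis
    unfolding isomorphic_categories_def
    by (intro exI[of _ "\<lambda>X. X"] exI[of _ F] exI[of _ G]) (auto simp: GF)
qed

lemma is_category_Set_cat: "is_category Set_cat"
proof -
  have "compose W h (compose W g f) = compose W (compose X h g) f" if "f \<in> W \<rightarrow>\<^sub>E X"
    for W X :: "'a set" and f g h :: "'a \<Rightarrow> 'a"
    using that compose_assoc[of f W X h g] by auto
  moreover have "compose X g f \<in> X \<rightarrow>\<^sub>E Z" if "f \<in> X \<rightarrow>\<^sub>E Y" "g \<in> Y \<rightarrow>\<^sub>E Z"
    for X Y Z :: "'a set" and f g :: "'a \<Rightarrow> 'a"
    using that by (auto simp: PiE_iff compose_def)
  moreover have "compose X f (\<lambda>x\<in>X. x) = f" "compose X (\<lambda>y\<in>Y. y) f = f" if "f \<in> X \<rightarrow>\<^sub>E Y"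
    for X Y :: "'a set" and f :: "'a \<Rightarrow> 'a"
    using that by (auto simp: PiE_iff intro: compose_Id Id_compose)
  ultimately show ?thesis
    unfolding is_category_def Set_cat_def by auto
qed

lemma isomorphic_Set_QMap:
  assumes "lean TYPE('q::nontrivial_comm_unital_quantale)"
  shows "isomorphic_categories (Set_cat :: ('u set, 'u \<Rightarrow> 'u) cat)
    (QMap_cat :: ('u set, 'u \<times> 'u \<Rightarrow> 'q) cat)"
proof (rule isomorphic_categoriesI[OF is_category_Set_cat, where F = qgraph])
  fix X Y :: "'u set"
  have "qgraph X Y ` (X \<rightarrow>\<^sub>E Y) = {\<zeta> :: _ \<Rightarrow> 'q. is_qmap X Y \<zeta>}"
    using qmap_is_qgraph[OF assms] is_qmap_qgraph[of _ X Y] by fastforce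
  then show "bij_betw (qgraph X Y) (Hom Set_cat X Y)
      (Hom (QMap_cat :: ('u set, 'u \<times> 'u \<Rightarrow> 'q) cat) X Y)"
    by (simp add: bij_betw_def Set_cat_def QMap_cat_def inj_on_qgraph)
next
  fix X Y Z :: "'u set" and f g :: "'u \<Rightarrow> 'u"
  assume "f \<in> Hom Set_cat X Y"
  then have "f \<in> X \<rightarrow> Y"
    by (auto simp: Set_cat_def)
  then show "qgraph X Z (Comp Set_cat X Y Z g f) =
      Comp (QMap_cat :: ('u set, 'u \<times> 'u \<Rightarrow> 'q) cat) X Y Z (qgraph Y Z g) (qgraph X Y f)"
    by (simp add: Set_cat_def QMap_cat_def qgraph_compose)
qed (simp_all add: Set_cat_def QMap_cat_def qgraph_id)

theorem theorem3p16:
  assumes "\<exists>a b :: 'u. a \<noteq> b"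
  shows "((\<forall>(X :: 'u set) (Y :: 'u set) (\<zeta> :: 'u \<times> 'u \<Rightarrow> 'q::nontrivial_comm_unital_quantale).
             is_qmap X Y \<zeta> \<longrightarrow> (\<exists>f \<in> X \<rightarrow>\<^sub>E Y. \<zeta> = qgraph X Y f))
           \<longleftrightarrow> lean TYPE('q)) \<and>
         (lean TYPE('q) \<longrightarrow>
            isomorphic_categories (Set_cat :: ('u set, 'u \<Rightarrow> 'u) cat)
              (QMap_cat :: ('u set, 'u \<times> 'u \<Rightarrow> 'q) cat))"
proof (intro conjI iffI impI allI)
  assume "\<forall>(X :: 'u set) (Y :: 'u set) (\<zeta> :: 'u \<times> 'u \<Rightarrow> 'q).
    is_qmap X Y \<zeta> \<longrightarrow> (\<exists>f \<in> X \<rightarrow>\<^sub>E Y. \<zeta> = qgraph X Y f)"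
  then show "lean TYPE('q)"
    by (intro lean_if_qmaps_are_qgraphs[OF assms]) simp
qed (rule qmap_is_qgraph isomorphic_Set_QMap; assumption)+

end
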